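(* Let $n\geq 1$ and let $M=(m_{ij})\in\mathbb{R}^{n\times n}$ be a nonnegative real matrix such that $2m_{ii}>m_{ij}$ for every $i,j$ with $1\leq i,j\leq n$. Then there exists a unique positive vector $\mathbf{x}=(x_1,\dots,x_n)^t$ such that $M\mathbf{x}=\left(\frac{1}{x_1},\dots,\frac{1}{x_n}\right)^t$.
   Context: A vector or a matrix is nonnegative (resp. positive) if all of its entries are nonnegative (resp. positive). *)

theory Defs
  imports "HOL-Analysis.Analysis"
begin

end

theory Submission
  imports Defs
begin

text \<open>The case \<open>j = i\<close> of the hypothesis makes the diagonal positive. For existence, solve the
  \<open>i\<close>-th equation for \<open>x\<^sub>i\<close> in terms of the other coordinates: the positive root of the quadratic
  \<open>m\<^sub>i\<^sub>i x\<^sub>i\<^sup>2 + b x\<^sub>i = 1\<close> depends continuously on \<open>b \<ge> 0\<close> and is at most \<open>1 / sqrt m\<^sub>i\<^sub>i\<close>, so Brouwer's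
  theorem on a box gives a solution. For uniqueness, let \<open>U\<close> and \<open>L\<close> be the largest and the smallest
  ratio \<open>y\<^sub>i / x\<^sub>i\<close> of two solutions. The equations at these two indices give \<open>U L \<le> 1\<close> and
  \<open>U L \<ge> 1\<close>, and equality at the index of \<open>U\<close> forces \<open>U = L\<close> because the diagonal is positive.\<close>

text \<open>\<open>r\<close> is the root \<open>(sqrt (b\<^sup>2 + 4 * a) - b) / (2 * a)\<close>
  after rationalising the numerator. The denominator is now a sum that is at least
  \<open>2 * sqrt a\<close>, which yields a bound independent of \<open>b\<close>.\<close>

lemma positive_root_quadratic:
  fixes a b :: real
  assumes "a > 0" "b \<ge> 0"
  defines "r \<equiv> 2 / (b + sqrt (b\<^sup>2 + 4 * a))"
  shows "r > 0" "r \<le> 1 / sqrt a" "r * (a * r + b) = 1"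
proof -
  define s where "s = sqrt (b\<^sup>2 + 4 * a)"
  have s2: "s * s = b * b + 4 * a"
    using assms by (simp add: s_def power2_eq_square)
  have "sqrt (4 * a) \<le> s"
    unfolding s_def using assms by (intro real_sqrt_le_mono) simp
  then have s: "2 * sqrt a \<le> s"
    by (simp add: real_sqrt_mult)
  moreover have "sqrt a > 0"
    using assms by simp
  ultimately have pos: "b + s > 0"
    using assms by linarith
  have r: "r = 2 / (b + s)"
    by (simp add: r_def s_def)
  show "r > 0"
    using pos by (simp add: r)
  show "r \<le> 1 / sqrt a"
    using frac_le[of 2 2 "2 * sqrt a" "b + s"] s \<open>sqrt a > 0\<close> assms(2) by (simp add: r)
  have "2 * (2 * a + b * (b + s)) = (b + s) * (b + s)"
    using s2 by (simp add: algebra_simps)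
  moreover have "r * (a * r + b) = 2 * (2 * a + b * (b + s)) / ((b + s) * (b + s))"
    using pos by (simp add: r field_simps)
  ultimately show "r * (a * r + b) = 1"
    using pos by simp
qed

lemma exists_positive_reciprocal_vector:
  fixes M :: "real ^ 'n ^ 'n"
  assumes nonneg: "\<And>i j. M $ i $ j \<ge> 0" and diag: "\<And>i. M $ i $ i > 0"
  shows "\<exists>x. (\<forall>i. x $ i > 0) \<and> (\<forall>i. x $ i * (M *v x) $ i = 1)"
proof -
  define b where "b x i = (\<Sum>j\<in>UNIV - {i}. M $ i $ j * x $ j)" for x :: "real ^ 'n" and i
  define f where "f x = (\<chi> i. 2 / (b x i + sqrt ((b x i)\<^sup>2 + 4 * M $ i $ i)))" for x
  \<comment> \<open>The upper corner is the bound on the roots that is uniform in \<open>b\<close>,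
    so \<open>f\<close> maps the box into itself.\<close>
  define S where "S = cbox (0 :: real ^ 'n) (\<chi> i. 1 / sqrt (M $ i $ i))"
  have b_nonneg: "b x i \<ge> 0" if "x \<in> S" for x i
    using that nonneg by (auto simp: b_def S_def mem_box_cart intro!: sum_nonneg mult_nonneg_nonneg)
  have root: "f x $ i > 0" "f x $ i \<le> 1 / sqrt (M $ i $ i)"
    "f x $ i * (M $ i $ i * f x $ i + b x i) = 1" if "x \<in> S" for x i
    using positive_root_quadratic[OF diag b_nonneg[OF that], of i i] by (simp_all add: f_def)
  have denominator: "b x i + sqrt ((b x i)\<^sup>2 + 4 * M $ i $ i) \<noteq> 0" if "x \<in> S" for x i
  proof -
    have "(b x i)\<^sup>2 + 4 * M $ i $ i > 0"
      using diag[of i] by (intro add_nonneg_pos) auto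
    then show ?thesis
      using add_nonneg_pos[OF b_nonneg[OF that, of i], of "sqrt ((b x i)\<^sup>2 + 4 * M $ i $ i)"]
      by simp
  qed
  have "S \<noteq> {}"
    using diag by (auto simp: S_def interval_ne_empty_cart less_imp_le)
  moreover have "continuous_on S f"
    unfolding f_def using denominator
    by (intro continuous_on_vec_lambda continuous_intros) (auto simp: b_def intro!: continuous_intros)
  moreover have "f \<in> S \<rightarrow> S"
    using root by (auto simp: S_def mem_box_cart less_imp_le)
  ultimately obtain x where x: "x \<in> S" "f x = x"
    using brouwer[of S f] by (auto simp: S_def)
  have "(M *v x) $ i = M $ i $ i * x $ i + b x i" for i
    by (simp add: matrix_vector_mult_def b_def sum.remove[of UNIV i])
  \<comment> \<open>Points of \<open>S\<close> may have zero coordinates, but all values of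
    \<open>f\<close> are positive, hence so is its fixed point.\<close>
  then show ?thesis
    using root[OF x(1)] unfolding x(2) by (intro exI[of _ x]) simp
qed

lemma positive_reciprocal_vector_unique:
  fixes M :: "real ^ 'n ^ 'n"
  assumes nonneg: "\<And>i j. M $ i $ j \<ge> 0" and diag: "\<And>i. M $ i $ i > 0"
    and x: "\<And>i. x $ i > 0" "\<And>i. x $ i * (M *v x) $ i = 1"
    and y: "\<And>i. y $ i > 0" "\<And>i. y $ i * (M *v y) $ i = 1"
  shows "x = y"
proof -
  define u where "u i = y $ i / x $ i" for i
  obtain p where p: "\<And>i. u i \<le> u p"
    using Max_in[of "range u"] Max_ge[of "range u"] by fastforce
  obtain q where q: "\<And>i. u q \<le> u i"
    using Min_in[of "range u"] Min_le[of "range u"] by fastforce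
  have u_pos: "u i > 0" and y_eq: "y $ i = u i * x $ i" for i
    using x(1)[of i] y(1)[of i] by (simp_all add: u_def)
  have lower: "u q * x $ j \<le> y $ j" and upper: "y $ j \<le> u p * x $ j" for j
    using p[of j] q[of j] x(1)[of j] by (simp_all add: y_eq)
  have My_p: "(M *v y) $ p - u q * (M *v x) $ p = (\<Sum>j\<in>UNIV. M $ p $ j * (y $ j - u q * x $ j))"
    by (simp add: matrix_vector_mult_def sum_distrib_left sum_subtractf algebra_simps)
  have My_q: "u p * (M *v x) $ q - (M *v y) $ q = (\<Sum>j\<in>UNIV. M $ q $ j * (u p * x $ j - y $ j))"
    by (simp add: matrix_vector_mult_def sum_distrib_left sum_subtractf algebra_simps)
  \<comment> \<open>Row \<open>q\<close> of \<open>y \<le> u p * x\<close>; multiplying by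
    \<open>y $ q = u q * x $ q\<close> turns both sides into known products.\<close>
  have "(M *v y) $ q \<le> u p * (M *v x) $ q"
    using My_q sum_nonneg[of UNIV "\<lambda>j. M $ q $ j * (u p * x $ j - y $ j)"] nonneg upper by simp
  then have "y $ q * (M *v y) $ q \<le> (u q * x $ q) * (u p * (M *v x) $ q)"
    using y(1)[of q] by (simp add: y_eq[symmetric])
  also have "\<dots> = u p * u q * (x $ q * (M *v x) $ q)"
    by simp
  finally have UL: "u p * u q \<ge> 1"
    using x(2) y(2) by simp
  \<comment> \<open>Multiplied by \<open>y $ p\<close>, the difference in row \<open>p\<close>
    becomes \<open>1 - u p * u q\<close>.\<close>
  have "u p * x $ p * ((M *v y) $ p - u q * (M *v x) $ p)
      = y $ p * (M *v y) $ p - u p * u q * (x $ p * (M *v x) $ p)"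
    by (simp add: y_eq[of p] algebra_simps)
  also have "\<dots> \<le> 0"
    using UL x(2) y(2) by simp
  finally have "(M *v y) $ p - u q * (M *v x) $ p \<le> 0"
    using u_pos[of p] x(1)[of p] by (auto simp: mult_le_0_iff)
  \<comment> \<open>All summands of \<open>My_p\<close> are nonnegative, so the diagonal one is at
    most their sum, which is at most 0.\<close>
  moreover have "M $ p $ p * (y $ p - u q * x $ p) \<le> (M *v y) $ p - u q * (M *v x) $ p"
    unfolding My_p using nonneg lower by (intro member_le_sum) auto
  ultimately have "M $ p $ p * (y $ p - u q * x $ p) \<le> 0"
    by (rule order_trans[rotated])
  then have "y $ p \<le> u q * x $ p"
    using diag[of p] by (auto simp: mult_le_0_iff)
  then have "u p = u q"
    using x(1)[of p] q[of p] by (simp add: y_eq)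
  then have const: "u i = u p" for i
    using p[of i] q[of i] by simp
  have "y $ i = u p * x $ i" for i
    using y_eq[of i] unfolding const[of i] .
  then have y_scale: "y = u p *\<^sub>R x"
    by (simp add: vec_eq_iff)
  \<comment> \<open>Scaling \<open>x\<close> by \<open>u p\<close> multiplies each product by
    \<open>(u p)\<^sup>2\<close>, and both products are 1.\<close>
  have "M *v y = u p *\<^sub>R (M *v x)"
    unfolding y_scale by (rule matrix_vector_mult_scaleR)
  then have "(u p)\<^sup>2 * (x $ p * (M *v x) $ p) = 1"
    using y(2)[of p] by (simp add: y_eq[of p] power2_eq_square ac_simps)
  then have "u p = 1"
    using x(2) u_pos[of p] by (simp add: power2_eq_1_iff)
  then show ?thesis
    using y_scale by simp
qed

theorem proposition12:
  fixes M :: "real ^ 'n ^ 'n"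
  assumes nonneg: "\<forall>i j. M $ i $ j \<ge> 0"
    and diag: "\<forall>i j. 2 * M $ i $ i > M $ i $ j"
  shows "\<exists>!x :: real ^ 'n. (\<forall>i. x $ i > 0) \<and> M *v x = (\<chi> i. 1 / x $ i)"
proof -
  have diag_pos: "M $ i $ i > 0" for i
    using diag[rule_format, of i i] by simp
  \<comment> \<open>Positivity rules out the default value \<open>1 / 0 = 0\<close>, so the equation
    can be cleared of denominators.\<close>
  have reciprocal_iff: "M *v x = (\<chi> i. 1 / x $ i) \<longleftrightarrow> (\<forall>i. x $ i * (M *v x) $ i = 1)"
    if "\<forall>i. x $ i > 0" for x
  proof -
    have "x $ i \<noteq> 0" for i
      using that[rule_format, of i] by simp
    then show ?thesis
      by (simp add: vec_eq_iff eq_divide_eq mult.commute)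
  qed
  obtain x where x: "\<forall>i. x $ i > 0" "\<forall>i. x $ i * (M *v x) $ i = 1"
    using exists_positive_reciprocal_vector[of M] nonneg diag_pos by blast
  show ?thesis
  proof (rule ex1I[of _ x])
    show "(\<forall>i. x $ i > 0) \<and> M *v x = (\<chi> i. 1 / x $ i)"
      using x reciprocal_iff by blast
    show "y = x" if "(\<forall>i. y $ i > 0) \<and> M *v y = (\<chi> i. 1 / y $ i)" for y
    proof (rule positive_reciprocal_vector_unique[of M])
      show "y $ i * (M *v y) $ i = 1" for i
        using that reciprocal_iff by blast
    qed (use that x nonneg diag_pos in auto)
  qed
qed

end
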